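(* Let $k\ge2$, $m=2k-1$, and $1\le a,b\le m$, and consider the word $P=MVMMMM$. Let $\operatorname{FullCompat}(k;a,b)$ mean that there is at least one state in $F(MVMMMM,k)$ whose restriction to the upper faces is $A(W_a)$ and whose restriction to the lower faces is $B(\operatorname{rev}(W_b))$. Define $B_R(1)=0$ and $B_R(p)=\lfloor p/2\rfloor$ for $p\ge 2$. Then $$\operatorname{FullCompat}(k;a,b)\iff B_R(a)=B_R(b).$$ For every compatible ordered pair $(a,b)$ there is exactly one state of $F(MVMMMM,k)$ with these row restrictions, and every state in $F(MVMMMM,k)$ determines one such compatible pair, namely the unique $(a,b)\in\{1,\dots,m\}^2$ such that its upper and lower row restrictions are $A(W_a)$ and $B(\operatorname{rev}(W_b))$.
   Context: Map and assignment. Let $k\ge2$, $n=2k$. The upper faces are $A_1,\dots,A_n$, the lower faces $B_1,\dots,B_n$. The creases are $H_c=(A_c,B_c)$ ($1\le c\le n$), $U_i=(A_i,A_{i+1})$ and $L_i=(B_i,B_{i+1})$ ($1\le i\le n-1$); the two faces of a crease are its wings. A word $P=(h_0,h_1,u_0,u_1,l_0,l_1)\in\{M,V\}^6$ (written as a six-letter string) assigns to $H_c$ the label $h_{(c-1)\bmod 2}$ and to $U_i,L_i$ the labels $u_{(i-1)\bmod2},l_{(i-1)\bmod2}$. The assignment is locally flat-foldable if for every $1\le c\le n-1$ an odd number of the four creases $H_c,H_{c+1},U_c,L_c$ (meeting at an interior vertex) are labelled $M$. States. $x\prec y$ means $x$ lies above (comes before) $y$ in a total order. A strict total order of all $4k$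 labelled faces is order-valid for $P$ if: (i) Precedence: with $A_c$ in row $r=0$ and $B_c$ in row $r=1$, the face in row $r$, column $c$ is light-up iff $r+c-1$ is even and dark-up otherwise; across each $M$ crease the light-up wing precedes the dark-up wing, across each $V$ crease the dark-up wing precedes the light-up wing. (ii) Noncrossing: every $H_c$ has target class $S$; $U_i$ and $L_i$ have class $E$ for $i$ odd and $W$ for $i$ even; for any two distinct creases of the same target class with disjoint wing sets, with wing positions $a_0<a_1$ and $b_0<b_1$ in the order, neither $a_0<b_0<a_1<b_1$ nor $b_0<a_0<b_1<a_1$. $F(P,k)$ is the set of all order-valid strict total orders if $P$ is locally flat-foldable, and $F(P,k)=\varnothing$ otherwise. Row words. Write $O_i=2i-1$, $D_i=2i$ for $1\le i\le k$. For $1\le p\le 2k-1$ define the column word $W_p$ by $W_{2s-1}=(O_s,O_{s-1},\dots,O_1,D_1,\dots,D_{s-1},O_{s+1},\dots,O_k,D_k,\dots,D_{s+1},D_s)$ and $W_{2s}=(O_{s+1},\dots,O_k,D_k,\dots,D_{s+1},O_s,\dots,O_1,D_1,\dots,D_s)$, empty blocks omitted; $\operatorname{rev}$ denotes reversal of a word. For a column word $W=(c_1,\dots,c_n)$, $A(W)$ is the order $A_{c_1}\prec\cdots\prec A_{c_n}$ and $B(W)$ the order $B_{c_1}\prec\cdots\prec B_{c_n}$. The index $p$ is called the pivot. *)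

theory Defs
  imports Main
begin

datatype face = FaceA nat | FaceB nat

datatype crease = CreaseH nat | CreaseU nat | CreaseL nat

datatype label = M | V

datatype target = South | East | West

definition upper_faces :: "nat \<Rightarrow> face set" where
  "upper_faces k = FaceA ` {1..2 * k}"

definition lower_faces :: "nat \<Rightarrow> face set" where
  "lower_faces k = FaceB ` {1..2 * k}"

definition faces :: "nat \<Rightarrow> face set" where
  "faces k = upper_faces k \<union> lower_faces k"

definition creases :: "nat \<Rightarrow> crease set" where
  "creases k = CreaseH ` {1..2 * k} \<union> CreaseU ` {1..2 * k - 1} \<union> CreaseL ` {1..2 * k - 1}"

fun wings :: "crease \<Rightarrow> face set" where
  "wings (CreaseH c) = {FaceA c, FaceB c}"
| "wings (CreaseU i) = {FaceA i, FaceA (i + 1)}"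
| "wings (CreaseL i) = {FaceB i, FaceB (i + 1)}"

text \<open>The components are \<open>(h\<^sub>0, h\<^sub>1, u\<^sub>0, u\<^sub>1, l\<^sub>0, l\<^sub>1)\<close>. Here and below, indices start at 1, so that
  the truncated subtraction \<open>- 1\<close> on \<open>nat\<close> is exact.\<close>

type_synonym assignment = "label \<times> label \<times> label \<times> label \<times> label \<times> label"

fun label_of :: "assignment \<Rightarrow> crease \<Rightarrow> label" where
  "label_of (h0, h1, u0, u1, l0, l1) (CreaseH c) = (if (c - 1) mod 2 = 0 then h0 else h1)"
| "label_of (h0, h1, u0, u1, l0, l1) (CreaseU i) = (if (i - 1) mod 2 = 0 then u0 else u1)"
| "label_of (h0, h1, u0, u1, l0, l1) (CreaseL i) = (if (i - 1) mod 2 = 0 then l0 else l1)"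

definition locally_flat_foldable :: "nat \<Rightarrow> assignment \<Rightarrow> bool" where
  "locally_flat_foldable k P \<longleftrightarrow>
     (\<forall>c\<in>{1..2 * k - 1}.
        odd (card {e \<in> {CreaseH c, CreaseH (c + 1), CreaseU c, CreaseL c}. label_of P e = M}))"

fun row :: "face \<Rightarrow> nat" where
  "row (FaceA c) = 0"
| "row (FaceB c) = 1"

fun column :: "face \<Rightarrow> nat" where
  "column (FaceA c) = c"
| "column (FaceB c) = c"

definition light_up :: "face \<Rightarrow> bool" where
  "light_up x \<longleftrightarrow> even (row x + column x - 1)"

fun target_class :: "crease \<Rightarrow> target" where
  "target_class (CreaseH c) = South"
| "target_class (CreaseU i) = (if odd i then East else West)"
| "target_class (CreaseL i) = (if odd i then East else West)"

text \<open>In an order \<open>r\<close>, the pair \<open>(x, y) \<in> r\<close> means \<open>x \<prec> y\<close>, that is, \<open>x\<close> lies above \<open>y\<close>.\<close>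

definition strict_total_order :: "nat \<Rightarrow> face rel \<Rightarrow> bool" where
  "strict_total_order k r \<longleftrightarrow> r \<subseteq> faces k \<times> faces k \<and> strict_linear_order_on (faces k) r"

definition precedence :: "nat \<Rightarrow> assignment \<Rightarrow> face rel \<Rightarrow> bool" where
  "precedence k P r \<longleftrightarrow>
     (\<forall>e\<in>creases k. \<forall>x\<in>wings e. \<forall>y\<in>wings e. light_up x \<and> \<not> light_up y \<longrightarrow>
        (case label_of P e of M \<Rightarrow> (x, y) \<in> r | V \<Rightarrow> (y, x) \<in> r))"

definition noncrossing :: "nat \<Rightarrow> face rel \<Rightarrow> bool" where
  "noncrossing k r \<longleftrightarrow>
     (\<forall>e\<in>creases k. \<forall>f\<in>creases k.
        e \<noteq> f \<and> target_class e = target_class f \<and> wings e \<inter> wings f = {} \<longrightarrow>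
        (\<forall>a0 a1 b0 b1. wings e = {a0, a1} \<and> wings f = {b0, b1} \<and> (a0, a1) \<in> r \<and> (b0, b1) \<in> r \<longrightarrow>
           \<not> ((a0, b0) \<in> r \<and> (b0, a1) \<in> r \<and> (a1, b1) \<in> r) \<and>
           \<not> ((b0, a0) \<in> r \<and> (a0, b1) \<in> r \<and> (b1, a1) \<in> r)))"

definition order_valid :: "nat \<Rightarrow> assignment \<Rightarrow> face rel \<Rightarrow> bool" where
  "order_valid k P r \<longleftrightarrow> strict_total_order k r \<and> precedence k P r \<and> noncrossing k r"

definition states :: "assignment \<Rightarrow> nat \<Rightarrow> face rel set" where
  "states P k = (if locally_flat_foldable k P then {r. order_valid k P r} else {})"

text \<open>\<open>O\<^sub>i = 2i - 1\<close> and \<open>D\<^sub>i = 2i\<close>.\<close>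

definition odd_col :: "nat \<Rightarrow> nat" where
  "odd_col i = 2 * i - 1"

definition even_col :: "nat \<Rightarrow> nat" where
  "even_col i = 2 * i"

definition column_word_odd :: "nat \<Rightarrow> nat \<Rightarrow> nat list" where
  "column_word_odd k s =
     map odd_col (rev [1..<s + 1]) @ map even_col [1..<s] @
     map odd_col [s + 1..<k + 1] @ map even_col (rev [s..<k + 1])"

definition column_word_even :: "nat \<Rightarrow> nat \<Rightarrow> nat list" where
  "column_word_even k s =
     map odd_col [s + 1..<k + 1] @ map even_col (rev [s + 1..<k + 1]) @
     map odd_col (rev [1..<s + 1]) @ map even_col [1..<s + 1]"

text \<open>The word \<open>W\<^sub>p\<close>, with \<open>p = 2s - 1\<close> or \<open>p = 2s\<close>.\<close>

definition column_word :: "nat \<Rightarrow> nat \<Rightarrow> nat list" where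
  "column_word k p =
     (if odd p then column_word_odd k ((p + 1) div 2) else column_word_even k (p div 2))"

text \<open>The strict order in which the letters of a word without repetitions occur.\<close>

definition word_order :: "'a list \<Rightarrow> 'a rel" where
  "word_order xs = {(xs ! i, xs ! j) | i j. i < j \<and> j < length xs}"

definition order_A :: "nat list \<Rightarrow> face rel" where
  "order_A W = word_order (map FaceA W)"

definition order_B :: "nat list \<Rightarrow> face rel" where
  "order_B W = word_order (map FaceB W)"

definition restrict_order :: "face rel \<Rightarrow> face set \<Rightarrow> face rel" where
  "restrict_order r S = r \<inter> S \<times> S"

definition has_rows :: "nat \<Rightarrow> nat \<Rightarrow> nat \<Rightarrow> face rel \<Rightarrow> bool" where
  "has_rows k a b r \<longleftrightarrow>
     restrict_order r (upper_faces k) = order_A (column_word k a) \<and>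
     restrict_order r (lower_faces k) = order_B (rev (column_word k b))"

definition MVMMMM :: assignment where
  "MVMMMM = (M, V, M, M, M, M)"

definition FullCompat :: "nat \<Rightarrow> nat \<Rightarrow> nat \<Rightarrow> bool" where
  "FullCompat k a b \<longleftrightarrow> (\<exists>r\<in>states MVMMMM k. has_rows k a b r)"

definition B_R :: "nat \<Rightarrow> nat" where
  "B_R p = (if p = 1 then 0 else p div 2)"

lemma column_word_examples:
  "map (column_word 3) [1..<6] =
     [[1, 3, 5, 6, 4, 2], [3, 5, 6, 4, 1, 2], [3, 1, 2, 5, 6, 4],
      [5, 6, 3, 1, 2, 4], [5, 3, 1, 2, 4, 6]]"
  by (simp add: column_word_def column_word_odd_def column_word_even_def odd_col_def even_col_def
      upt_rec)

end

theory Submission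
  imports Defs
begin

text \<open>In the word \<open>MVMMMM\<close> every \<open>A\<^sub>c\<close> precedes \<open>B\<^sub>c\<close>, and \<open>O\<close>-columns precede the adjacent \<open>D\<close>-columns in
  the upper row and follow them in the lower row. So the upper row and the reversed lower row satisfy
  the same conditions. By noncrossing, the positions of \<open>O\<^sub>i, D\<^sub>i, O\<^sub>i\<^sub>+\<^sub>1, D\<^sub>i\<^sub>+\<^sub>1\<close> have three
  types: \<open>O\<^sub>i\<^sub>+\<^sub>1 O\<^sub>i D\<^sub>i D\<^sub>i\<^sub>+\<^sub>1\<close> (outward), \<open>O\<^sub>i\<^sub>+\<^sub>1 D\<^sub>i\<^sub>+\<^sub>1 O\<^sub>i D\<^sub>i\<close> (step) and
  \<open>O\<^sub>i O\<^sub>i\<^sub>+\<^sub>1 D\<^sub>i\<^sub>+\<^sub>1 D\<^sub>i\<close> (inward). After a step or an inward type only inward types follow, so the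
  sequence of types is outward, then at most one step, then inward; it determines the row, which is
  \<open>W\<^sub>p\<close> with \<open>p = 2s\<close> for a step at \<open>s\<close> and \<open>p = 2s - 1\<close> for inward types from \<open>s\<close> on without a step.

  The crease columns \<open>A\<^sub>c \<prec> B\<^sub>c\<close> are pairwise nested or disjoint and the two rows tell which, so
  the rows determine the state. Two columns \<open>O\<^sub>i, O\<^sub>i\<^sub>+\<^sub>1\<close> cannot be disjoint, since
  \<open>A\<^sub>O \<prec> A\<^sub>D \<prec> B\<^sub>D \<prec> B\<^sub>O\<close> for \<open>D = D\<^sub>i\<close> and either \<open>O\<close>; hence the upper and the reversed lower
  row order them alike, which is the condition \<open>B\<^sub>R(a) = B\<^sub>R(b)\<close>. Conversely, explicit ranks give a
  state for every such pair.\<close>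

section \<open>Orders given by words\<close>

lemma word_orderI: "i < j \<Longrightarrow> j < length xs \<Longrightarrow> (xs ! i, xs ! j) \<in> word_order xs"
  unfolding word_order_def by blast

lemma word_orderE:
  assumes "z \<in> word_order xs"
  obtains i j where "i < j" "j < length xs" "z = (xs ! i, xs ! j)"
  using assms unfolding word_order_def by blast

lemma word_order_rev: "word_order (rev xs) = (word_order xs)\<inverse>"
proof -
  have sub: "word_order (rev ys) \<subseteq> (word_order ys)\<inverse>" for ys :: "'a list"
  proof
    fix z assume "z \<in> word_order (rev ys)"
    then obtain i j where ij: "i < j" "j < length ys" and z: "z = (rev ys ! i, rev ys ! j)"
      by (auto elim: word_orderE)
    have "z = (ys ! (length ys - Suc i), ys ! (length ys - Suc j))"
      using ij z by (simp add: rev_nth)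
    moreover have "length ys - Suc j < length ys - Suc i" "length ys - Suc i < length ys"
      using ij by linarith+
    ultimately show "z \<in> (word_order ys)\<inverse>"
      using word_orderI by blast
  qed
  from sub[of xs] sub[of "rev xs"] show ?thesis by auto
qed

lemma word_order_map: "word_order (map f xs) = map_prod f f ` word_order xs"
proof
  show "word_order (map f xs) \<subseteq> map_prod f f ` word_order xs"
    by (auto elim!: word_orderE intro!: image_eqI[OF _ word_orderI])
  show "map_prod f f ` word_order xs \<subseteq> word_order (map f xs)"
  proof (clarsimp elim!: word_orderE)
    fix i j assume "i < j" "j < length xs"
    then show "(f (xs ! i), f (xs ! j)) \<in> word_order (map f xs)"
      using word_orderI[of i j "map f xs"] by simp
  qed
qed

lemma word_order_eq_linear_order:
  assumes lin: "strict_linear_order_on S r" and sub: "r \<subseteq> S \<times> S"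
    and sorted: "sorted_wrt (\<lambda>x y. (x, y) \<in> r) xs" and set: "set xs = S"
  shows "word_order xs = r"
proof
  show "word_order xs \<subseteq> r"
    using sorted by (auto elim!: word_orderE simp: sorted_wrt_iff_nth_less)
  show "r \<subseteq> word_order xs"
  proof
    fix z assume z: "z \<in> r"
    then have "fst z \<in> set xs" "snd z \<in> set xs"
      using sub set by auto
    then obtain i j where ij: "i < length xs" "j < length xs" "z = (xs ! i, xs ! j)"
      by (metis in_set_conv_nth prod.collapse)
    have irr: "(x, x) \<notin> r" for x
      using lin unfolding strict_linear_order_on_def by (meson irreflD)
    have "\<not> j < i"
    proof
      assume "j < i"
      then have "(xs ! j, xs ! i) \<in> r"
        using sorted ij(1) by (simp add: sorted_wrt_iff_nth_less)
      then show False
        using z ij(3) lin irr unfolding strict_linear_order_on_def by (meson transD)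
    qed
    moreover have "i \<noteq> j"
      using z ij(3) irr by auto
    ultimately show "z \<in> word_order xs"
      using ij by (auto intro: word_orderI)
  qed
qed

section \<open>Classification of the rows\<close>

lemma columns_eq: "{1..2 * k} = odd_col ` {1..k} \<union> even_col ` {1..k}"
proof
  show "{1..2 * k} \<subseteq> odd_col ` {1..k} \<union> even_col ` {1..k}"
  proof
    fix c assume "c \<in> {1..2 * k}"
    then have "(c + 1) div 2 \<in> {1..k}" "c = odd_col ((c + 1) div 2) \<or> c = even_col ((c + 1) div 2)"
      unfolding odd_col_def even_col_def by auto
    then show "c \<in> odd_col ` {1..k} \<union> even_col ` {1..k}"
      by blast
  qed
qed (auto simp: odd_col_def even_col_def)

lemma set_column_word:
  assumes "1 \<le> p" "p \<le> 2 * k - 1"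
  shows "set (column_word k p) = {1..2 * k}"
proof (cases "odd p")
  case True
  define s where "s = (p + 1) div 2"
  have "1 \<le> s" "s \<le> k"
    using assms True unfolding s_def by (auto elim!: oddE)
  then have "{1..k} = {1..<s + 1} \<union> {s + 1..<k + 1}" "{1..k} = {1..<s} \<union> {s..<k + 1}"
    by auto
  then show ?thesis
    using True unfolding columns_eq column_word_def column_word_odd_def s_def[symmetric]
    by (simp add: image_Un del: upt_Suc) blast
next
  case False
  define s where "s = p div 2"
  have "1 \<le> s" "s < k"
    using assms False unfolding s_def by (auto elim!: evenE)
  then have "{1..k} = {1..<s + 1} \<union> {s + 1..<k + 1}"
    by auto
  then show ?thesis
    using False unfolding columns_eq column_word_def column_word_even_def s_def[symmetric]
    by (simp add: image_Un del: upt_Suc) blast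
qed

text \<open>Position \<open>i\<close> is outward for \<open>2 * i < p\<close>, a step for
  \<open>p = 2 * i\<close> and inward for \<open>p < 2 * i\<close>. Two comparisons separate the
  three types, and inequalities in \<open>p\<close> treat both parities of the pivot alike.\<close>

definition has_pivot :: "nat \<Rightarrow> nat rel \<Rightarrow> nat \<Rightarrow> bool" where
  "has_pivot k R p \<longleftrightarrow> (\<forall>i\<in>{1..<k}.
     ((even_col (i + 1), even_col i) \<in> R \<longleftrightarrow> p \<le> 2 * i) \<and>
     ((odd_col (i + 1), odd_col i) \<in> R \<longleftrightarrow> 2 * i \<le> p))"

lemma has_pivot_unique:
  assumes "has_pivot k R p" "has_pivot k R q" "p \<in> {1..2 * k - 1}" "q \<in> {1..2 * k - 1}"
  shows "p = q"
proof -
  have False if "has_pivot k R p" "has_pivot k R q" "p < q" "1 \<le> p" "q \<le> 2 * k - 1" for p q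
  proof -
    \<comment> \<open>Here \<open>2 * i\<close> is \<open>p\<close> or \<open>p + 1\<close>. For
      even \<open>p\<close> the even columns at \<open>i\<close> tell \<open>p\<close> from
      \<open>q\<close>, for odd \<open>p\<close> the odd columns do.\<close>
    define i where "i = (p + 1) div 2"
    have "i \<in> {1..<k}" "p \<le> 2 * i \<and> \<not> q \<le> 2 * i \<or> \<not> 2 * i \<le> p \<and> 2 * i \<le> q"
      using that(3-) unfolding i_def by (auto simp: not_le; presburger)+
    then show False
      using that(1,2) unfolding has_pivot_def by metis
  qed
  from this[of p q] this[of q p] assms show ?thesis
    by (meson atLeastAtMost_iff linorder_neqE_nat)
qed

text \<open>The E creases of a row join \<open>O\<^sub>i\<close> to \<open>D\<^sub>i\<close>, its W
  creases join \<open>O\<^sub>i\<^sub>+\<^sub>1\<close> to \<open>D\<^sub>i\<close>. Noncrossing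
  enters only for consecutive creases of a class; this already leaves only the words as
  rows.\<close>

locale row_order =
  fixes k :: nat and R :: "nat rel"
  assumes subset: "R \<subseteq> {1..2 * k} \<times> {1..2 * k}"
    and linear: "strict_linear_order_on {1..2 * k} R"
    and odd_even: "1 \<le> i \<Longrightarrow> i \<le> k \<Longrightarrow> (odd_col i, even_col i) \<in> R"
    and next_odd_even: "1 \<le> i \<Longrightarrow> i < k \<Longrightarrow> (odd_col (i + 1), even_col i) \<in> R"
    and east: "1 \<le> i \<Longrightarrow> i < k \<Longrightarrow>
      \<not> ((odd_col i, odd_col (i + 1)) \<in> R \<and> (odd_col (i + 1), even_col i) \<in> R \<and>
         (even_col i, even_col (i + 1)) \<in> R) \<and>
      \<not> ((odd_col (i + 1), odd_col i) \<in> R \<and> (odd_col i, even_col (i + 1)) \<in> R \<and>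
         (even_col (i + 1), even_col i) \<in> R)"
    and west: "1 \<le> i \<Longrightarrow> i + 1 < k \<Longrightarrow>
      \<not> ((odd_col (i + 1), odd_col (i + 2)) \<in> R \<and> (odd_col (i + 2), even_col i) \<in> R \<and>
         (even_col i, even_col (i + 1)) \<in> R) \<and>
      \<not> ((odd_col (i + 2), odd_col (i + 1)) \<in> R \<and> (odd_col (i + 1), even_col (i + 1)) \<in> R \<and>
         (even_col (i + 1), even_col i) \<in> R)"
begin

lemma trans: "(x, y) \<in> R \<Longrightarrow> (y, z) \<in> R \<Longrightarrow> (x, z) \<in> R"
  using linear unfolding strict_linear_order_on_def by (meson transD)

lemma asym: "(x, y) \<in> R \<Longrightarrow> (y, x) \<notin> R"
  using linear trans unfolding strict_linear_order_on_def by (meson irreflD)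

lemma comparable:
  "x \<in> {1..2 * k} \<Longrightarrow> y \<in> {1..2 * k} \<Longrightarrow> x \<noteq> y \<Longrightarrow> (x, y) \<notin> R \<longleftrightarrow> (y, x) \<in> R"
  using linear asym unfolding strict_linear_order_on_def total_on_def by blast

lemma odd_cols_comparable:
  "1 \<le> i \<Longrightarrow> i \<le> k \<Longrightarrow> 1 \<le> j \<Longrightarrow> j \<le> k \<Longrightarrow> i \<noteq> j \<Longrightarrow>
   (odd_col i, odd_col j) \<notin> R \<longleftrightarrow> (odd_col j, odd_col i) \<in> R"
  by (rule comparable) (auto simp: odd_col_def)

lemma even_cols_comparable:
  "1 \<le> i \<Longrightarrow> i \<le> k \<Longrightarrow> 1 \<le> j \<Longrightarrow> j \<le> k \<Longrightarrow> i \<noteq> j \<Longrightarrow>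
   (even_col i, even_col j) \<notin> R \<longleftrightarrow> (even_col j, even_col i) \<in> R"
  by (rule comparable) (auto simp: even_col_def)

lemma odd_even_comparable:
  "1 \<le> i \<Longrightarrow> i \<le> k \<Longrightarrow> 1 \<le> j \<Longrightarrow> j \<le> k \<Longrightarrow>
   (odd_col i, even_col j) \<notin> R \<longleftrightarrow> (even_col j, odd_col i) \<in> R"
  by (rule comparable) (auto simp: odd_col_def even_col_def, presburger)

text \<open>Since \<open>O\<^sub>i\<^sub>+\<^sub>1\<close> precedes \<open>D\<^sub>i\<close>, the
  two E creases overlap; as they do not cross, the second is nested in the first.\<close>

lemma inward:
  assumes "1 \<le> i" "i < k" "(odd_col i, odd_col (i + 1)) \<in> R"
  shows "(even_col (i + 1), even_col i) \<in> R"
  using assms east[of i] next_odd_even[of i] even_cols_comparable[of i "i + 1"] by auto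

text \<open>\<open>D\<^sub>i\<^sub>+\<^sub>1\<close> lies between the wings
  \<open>O\<^sub>i\<^sub>+\<^sub>1\<close> and \<open>D\<^sub>i\<close> of a W crease, hence so does
  its W partner \<open>O\<^sub>i\<^sub>+\<^sub>2\<close>.\<close>

lemma inward_next:
  assumes "1 \<le> i" "i + 1 < k" "(even_col (i + 1), even_col i) \<in> R"
  shows "(odd_col (i + 1), odd_col (i + 2)) \<in> R"
  using assms west[of i] odd_even[of "i + 1"] odd_cols_comparable[of "i + 1" "i + 2"] by auto

text \<open>Both wings of one E crease precede the corresponding wings of the other; without a
  crossing the creases are disjoint.\<close>

lemma step:
  assumes "1 \<le> i" "i < k" "(odd_col (i + 1), odd_col i) \<in> R" "(even_col (i + 1), even_col i) \<in> R"
  shows "(even_col (i + 1), odd_col i) \<in> R"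
  using assms east[of i] odd_even_comparable[of i "i + 1"] by auto

text \<open>The same argument for W creases. It supplies the passage from even column
  \<open>s - 1\<close> to odd column \<open>s + 1\<close> in the words of odd pivot.\<close>

lemma turn:
  assumes "1 \<le> i" "i + 1 < k" "(even_col i, even_col (i + 1)) \<in> R"
    "(odd_col (i + 1), odd_col (i + 2)) \<in> R"
  shows "(even_col i, odd_col (i + 2)) \<in> R"
  using assms west[of i] odd_even_comparable[of "i + 2" i] by auto

text \<open>W and E conditions alternate: nested E creases order the next two odd columns, which
  nests the next pair of E creases.\<close>

lemma inward_persists:
  assumes "s < i" "i < k" "1 \<le> s" "(even_col (s + 1), even_col s) \<in> R"
  shows "(odd_col i, odd_col (i + 1)) \<in> R \<and> (even_col (i + 1), even_col i) \<in> R"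
  using assms(1)[folded Suc_le_eq] assms(2-)
proof (induction i rule: dec_induct)
  case base
  then show ?case
    using inward_next[of s] inward[of "s + 1"] by simp
next
  case (step i)
  then show ?case
    using inward_next[of i] inward[of "i + 1"] by simp
qed

lemma ex_pivot:
  assumes "k \<ge> 1"
  obtains p where "p \<in> {1..2 * k - 1}" "has_pivot k R p"
proof (cases "\<exists>i\<in>{1..<k}. (even_col (i + 1), even_col i) \<in> R")
  case False
  have "has_pivot k R (2 * k - 1)"
    unfolding has_pivot_def
  proof
    fix i assume i: "i \<in> {1..<k}"
    then have "(odd_col (i + 1), odd_col i) \<in> R"
      using False inward[of i] odd_cols_comparable[of i "i + 1"] by auto
    then show "((even_col (i + 1), even_col i) \<in> R \<longleftrightarrow> 2 * k - 1 \<le> 2 * i) \<and>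
        ((odd_col (i + 1), odd_col i) \<in> R \<longleftrightarrow> 2 * i \<le> 2 * k - 1)"
      using i False by auto
  qed
  then show ?thesis
    using that[of "2 * k - 1"] assms by auto
next
  case True
  \<comment> \<open>The first descent of even columns ends the outward types. The type at
    \<open>s\<close> is a step or inward, which decides between the pivots \<open>2 * s\<close> and
    \<open>2 * s - 1\<close>.\<close>
  define s where "s = (LEAST i. i \<in> {1..<k} \<and> (even_col (i + 1), even_col i) \<in> R)"
  have s: "1 \<le> s" "s < k" "(even_col (s + 1), even_col s) \<in> R"
    using LeastI_ex[OF True[unfolded Bex_def]] unfolding s_def by auto
  have below: "(even_col (i + 1), even_col i) \<notin> R \<and> (odd_col (i + 1), odd_col i) \<in> R"
    if "1 \<le> i" "i < s" for i
  proof -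
    have "(even_col (i + 1), even_col i) \<notin> R"
      using not_less_Least[of i "\<lambda>i. i \<in> {1..<k} \<and> (even_col (i + 1), even_col i) \<in> R"] that s(2)
      unfolding s_def by auto
    then show ?thesis
      using inward[of i] odd_cols_comparable[of i "i + 1"] that s(2) by auto
  qed
  have above: "(even_col (i + 1), even_col i) \<in> R \<and> (odd_col (i + 1), odd_col i) \<notin> R"
    if "s < i" "i < k" for i
    using inward_persists[OF that s(1,3)] asym by blast
  define p where "p = (if (odd_col (s + 1), odd_col s) \<in> R then 2 * s else 2 * s - 1)"
  have "has_pivot k R p"
    unfolding has_pivot_def
  proof
    fix i assume "i \<in> {1..<k}"
    then show "((even_col (i + 1), even_col i) \<in> R \<longleftrightarrow> p \<le> 2 * i) \<and>
        ((odd_col (i + 1), odd_col i) \<in> R \<longleftrightarrow> 2 * i \<le> p)"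
      using below[of i] above[of i] s unfolding p_def
      by (cases i s rule: linorder_cases) auto
  qed
  moreover have "p \<in> {1..2 * k - 1}"
    using s unfolding p_def by auto
  ultimately show ?thesis
    using that by blast
qed

lemma pivot_facts:
  assumes "has_pivot k R p" "1 \<le> i" "i < k"
  shows "p \<le> 2 * i \<Longrightarrow> (even_col (i + 1), even_col i) \<in> R"
    and "2 * i < p \<Longrightarrow> (even_col i, even_col (i + 1)) \<in> R"
    and "2 * i \<le> p \<Longrightarrow> (odd_col (i + 1), odd_col i) \<in> R"
    and "p < 2 * i \<Longrightarrow> (odd_col i, odd_col (i + 1)) \<in> R"
  using assms odd_cols_comparable[of "i + 1" i] even_cols_comparable[of "i + 1" i]
  unfolding has_pivot_def by auto

section \<open>The word of a given pivot\<close>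

lemma successively_upt:
  assumes "\<And>i. m \<le> i \<Longrightarrow> i + 1 < n \<Longrightarrow> P i (i + 1)"
  shows "successively P [m..<n]"
  using assms
proof (induction n)
  case (Suc n)
  then show ?case
    using Suc.prems[of "n - 1"] by (cases "m < n") (auto simp: successively_append_iff last_upt)
qed simp

lemma successively_rev_upt:
  assumes "\<And>i. m \<le> i \<Longrightarrow> i + 1 < n \<Longrightarrow> P (i + 1) i"
  shows "successively P (rev [m..<n])"
  using successively_upt[of m n "\<lambda>x y. P y x"] assms by (simp add: successively_rev)

text \<open>By transitivity it suffices to compare adjacent letters: inside the blocks by
  \<open>pivot_facts\<close>, at their junctions mainly by \<open>odd_even\<close>,
  \<open>step\<close> and \<open>turn\<close>.\<close>

lemma column_word_eq:
  assumes k: "k \<ge> 2" and p: "p \<in> {1..2 * k - 1}" and pivot: "has_pivot k R p"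
  shows "word_order (column_word k p) = R"
proof (rule word_order_eq_linear_order[OF linear subset])
  have transp: "transp (\<lambda>x y. (x, y) \<in> R)"
    using trans by (auto intro: transpI)
  note facts = pivot_facts[OF pivot]
  have "successively (\<lambda>x y. (x, y) \<in> R) (column_word k p)"
  proof (cases "odd p")
    case True
    define s where "s = (p + 1) div 2"
    have s: "p = 2 * s - 1" "1 \<le> s" "s \<le> k"
      using p True unfolding s_def by (auto elim!: oddE)
    have blocks:
      "successively (\<lambda>x y. (x, y) \<in> R) (map odd_col (rev [1..<s + 1]))"
      "successively (\<lambda>x y. (x, y) \<in> R) (map even_col [1..<s])"
      "successively (\<lambda>x y. (x, y) \<in> R) (map odd_col [s + 1..<k + 1])"
      "successively (\<lambda>x y. (x, y) \<in> R) (map even_col (rev [s..<k + 1]))"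
      unfolding successively_map
      by (intro successively_upt successively_rev_upt facts; use s in linarith)+
    \<comment> \<open>Junctions of the four blocks. For \<open>s = 1\<close> the first block of even
      columns is empty, for \<open>s = k\<close> the second block of odd columns is, and other
      letters become adjacent.\<close>
    have "(odd_col 1, even_col 1) \<in> R" "(odd_col k, even_col k) \<in> R"
      using odd_even[of 1] odd_even[of k] k by auto
    moreover have "(odd_col 1, odd_col 2) \<in> R" if "s = 1"
      using facts(4)[of 1] that s k by (simp add: numeral_2_eq_2)
    moreover have "(even_col (s - 1), odd_col (s + 1)) \<in> R" if "1 < s" "s < k"
      using turn[of "s - 1"] facts(2)[of "s - 1"] facts(4)[of s] that s by simp
    moreover have "(even_col (k - 1), even_col k) \<in> R" if "s = k"
      using facts(2)[of "k - 1"] that s k by simp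
    ultimately show ?thesis
      using blocks True s k unfolding column_word_def column_word_odd_def s_def[symmetric]
      by (cases "s = 1"; cases "s = k")
        (simp_all add: successively_append_iff hd_map last_map hd_rev last_rev last_upt
          hd_upt hd_append last_append numeral_2_eq_2 del: upt_Suc)
  next
    case False
    define s where "s = p div 2"
    have s: "p = 2 * s" "1 \<le> s" "s < k"
      using p False unfolding s_def by (auto elim!: evenE)
    have blocks:
      "successively (\<lambda>x y. (x, y) \<in> R) (map odd_col [s + 1..<k + 1])"
      "successively (\<lambda>x y. (x, y) \<in> R) (map even_col (rev [s + 1..<k + 1]))"
      "successively (\<lambda>x y. (x, y) \<in> R) (map odd_col (rev [1..<s + 1]))"
      "successively (\<lambda>x y. (x, y) \<in> R) (map even_col [1..<s + 1])"
      unfolding successively_map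
      by (intro successively_upt successively_rev_upt facts; use s in linarith)+
    have "(odd_col k, even_col k) \<in> R" "(even_col (s + 1), odd_col s) \<in> R"
      "(odd_col 1, even_col 1) \<in> R"
      using odd_even[of 1] odd_even[of k] facts(1)[of s] facts(3)[of s] step[of s] s k by auto
    then show ?thesis
      using blocks False s k unfolding column_word_def column_word_even_def s_def[symmetric]
      by (simp add: successively_append_iff hd_map last_map hd_rev last_rev last_upt
          hd_upt hd_append last_append del: upt_Suc)
  qed
  then show "sorted_wrt (\<lambda>x y. (x, y) \<in> R) (column_word k p)"
    using successively_conv_sorted_wrt[OF transp] by blast
  show "set (column_word k p) = {1..2 * k}"
    using p by (intro set_column_word) auto
qed

end

section \<open>States and their rows\<close>

text \<open>The wing that precedence puts first under \<open>MVMMMM\<close>. Between odd and even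
  columns the label of \<open>CreaseH\<close> changes together with its light-up wing, so the upper
  face always comes first.\<close>

fun top_wing :: "crease \<Rightarrow> face" where
  "top_wing (CreaseH c) = FaceA c"
| "top_wing (CreaseU i) = FaceA (if odd i then i else i + 1)"
| "top_wing (CreaseL i) = FaceB (if odd i then i + 1 else i)"

fun bottom_wing :: "crease \<Rightarrow> face" where
  "bottom_wing (CreaseH c) = FaceB c"
| "bottom_wing (CreaseU i) = FaceA (if odd i then i + 1 else i)"
| "bottom_wing (CreaseL i) = FaceB (if odd i then i else i + 1)"

lemma wings_eq: "wings e = {top_wing e, bottom_wing e}"
  by (cases e) auto

lemma crease_wings:
  assumes "1 \<le> i"
  shows "top_wing (CreaseU (odd_col i)) = FaceA (odd_col i)"
    and "bottom_wing (CreaseU (odd_col i)) = FaceA (even_col i)"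
    and "top_wing (CreaseU (even_col i)) = FaceA (odd_col (i + 1))"
    and "bottom_wing (CreaseU (even_col i)) = FaceA (even_col i)"
    and "top_wing (CreaseL (odd_col i)) = FaceB (even_col i)"
    and "bottom_wing (CreaseL (odd_col i)) = FaceB (odd_col i)"
    and "top_wing (CreaseL (even_col i)) = FaceB (even_col i)"
    and "bottom_wing (CreaseL (even_col i)) = FaceB (odd_col (i + 1))"
  using assms by (auto simp: odd_col_def even_col_def)

lemma odd_col_parity [simp]: "1 \<le> i \<Longrightarrow> odd (odd_col i)"
  and even_col_parity [simp]: "even (even_col i)"
  by (auto simp: odd_col_def even_col_def)

lemma odd_col_eq_iff: "1 \<le> i \<Longrightarrow> 1 \<le> j \<Longrightarrow> odd_col i = odd_col j \<longleftrightarrow> i = j"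
  and even_col_eq_iff: "even_col i = even_col j \<longleftrightarrow> i = j"
  by (auto simp: odd_col_def even_col_def)

text \<open>Each target class is a matching, so \<open>e \<noteq> f\<close> can stand for the
  disjointness condition of \<open>noncrossing\<close>.\<close>

lemma same_class_disjoint:
  assumes "target_class e = target_class f" "e \<noteq> f"
  shows "wings e \<inter> wings f = {}"
  using assms by (cases e; cases f) (auto split: if_splits)

text \<open>One of the two crossing patterns, with the wings already in order; exchanging
  \<open>e\<close> and \<open>f\<close> gives the other.\<close>

definition straddles :: "face rel \<Rightarrow> crease \<Rightarrow> crease \<Rightarrow> bool" where
  "straddles r e f \<longleftrightarrow> (top_wing e, top_wing f) \<in> r \<and> (top_wing f, bottom_wing e) \<in> r \<and>
     (bottom_wing e, bottom_wing f) \<in> r"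

lemma precedence_MVMMMM:
  "precedence k MVMMMM r \<longleftrightarrow> (\<forall>e\<in>creases k. (top_wing e, bottom_wing e) \<in> r)"
proof -
  have "(\<forall>x\<in>wings e. \<forall>y\<in>wings e. light_up x \<and> \<not> light_up y \<longrightarrow>
        (case label_of MVMMMM e of M \<Rightarrow> (x, y) \<in> r | V \<Rightarrow> (y, x) \<in> r)) \<longleftrightarrow>
      (top_wing e, bottom_wing e) \<in> r" if "e \<in> creases k" for e
    using that unfolding creases_def
    by (cases e) (auto simp: light_up_def MVMMMM_def even_iff_mod_2_eq_zero[symmetric])
  then show ?thesis
    unfolding precedence_def by blast
qed

text \<open>Exactly one of two neighbouring \<open>CreaseH\<close> is labelled \<open>M\<close>;
  with \<open>CreaseU c\<close> and \<open>CreaseL c\<close> this makes three.\<close>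

lemma locally_flat_foldable_MVMMMM: "locally_flat_foldable k MVMMMM"
proof -
  have "{e \<in> {CreaseH c, CreaseH (c + 1), CreaseU c, CreaseL c}. label_of MVMMMM e = M} =
      {CreaseH (if odd c then c else c + 1), CreaseU c, CreaseL c}" if "1 \<le> c" for c
    using that unfolding MVMMMM_def by (auto split: if_splits simp: even_iff_mod_2_eq_zero[symmetric])
  then show ?thesis
    unfolding locally_flat_foldable_def by simp
qed

lemma states_MVMMMM:
  "r \<in> states MVMMMM k \<longleftrightarrow> strict_total_order k r \<and>
     (\<forall>e\<in>creases k. (top_wing e, bottom_wing e) \<in> r) \<and>
     (\<forall>e\<in>creases k. \<forall>f\<in>creases k. e \<noteq> f \<and> target_class e = target_class f \<longrightarrow> \<not> straddles r e f)"
    (is "_ \<longleftrightarrow> ?order \<and> ?prec \<and> ?nc")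
proof -
  have "noncrossing k r \<longleftrightarrow> ?nc" if order: ?order and prec: ?prec
  proof
    assume nc: "noncrossing k r"
    show ?nc
      using nc prec same_class_disjoint unfolding noncrossing_def straddles_def wings_eq by metis
  next
    assume nc: ?nc
    have "(x, x) \<notin> r" "(x, y) \<in> r \<Longrightarrow> (y, x) \<notin> r" for x y
      using order unfolding strict_total_order_def strict_linear_order_on_def
      by (meson irreflD transD)+
    \<comment> \<open>Asymmetry leaves one way to name the wings in order, so the two patterns
      become \<open>straddles r e f\<close> and \<open>straddles r f e\<close>.\<close>
    then have "a0 = top_wing e \<and> a1 = bottom_wing e"
      if "wings e = {a0, a1}" "(a0, a1) \<in> r" "e \<in> creases k" for e a0 a1
      using that prec unfolding wings_eq by (metis doubleton_eq_iff)
    then show "noncrossing k r"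
      using nc unfolding noncrossing_def straddles_def by metis
  qed
  then show ?thesis
    unfolding states_def order_valid_def precedence_MVMMMM
    using locally_flat_foldable_MVMMMM by auto
qed

text \<open>The lower row is reversed, so that both rows are instances of \<open>row_order\<close>.\<close>

definition upper_row :: "face rel \<Rightarrow> nat rel" where
  "upper_row r = {(c, d). (FaceA c, FaceA d) \<in> r}"

definition lower_row :: "face rel \<Rightarrow> nat rel" where
  "lower_row r = {(c, d). (FaceB d, FaceB c) \<in> r}"

lemma has_rows_iff:
  assumes "r \<subseteq> faces k \<times> faces k"
  shows "has_rows k a b r \<longleftrightarrow>
    word_order (column_word k a) = upper_row r \<and> word_order (column_word k b) = lower_row r"
proof -
  have "restrict_order r (upper_faces k) = map_prod FaceA FaceA ` upper_row r"
    using assms unfolding restrict_order_def upper_row_def upper_faces_def lower_faces_def faces_def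
    by (auto simp: image_iff)
  moreover have "restrict_order r (lower_faces k) = map_prod FaceB FaceB ` ((lower_row r)\<inverse>)"
    using assms unfolding restrict_order_def lower_row_def upper_faces_def lower_faces_def faces_def
    by (auto simp: image_iff)
  moreover have "inj (map_prod FaceA FaceA)" "inj (map_prod FaceB FaceB)"
    by (auto intro!: prod.inj_map injI)
  ultimately show ?thesis
    unfolding has_rows_def order_A_def order_B_def word_order_map word_order_rev
    by (auto simp: inj_image_eq_iff)
qed

locale state =
  fixes k :: nat and r :: "face rel"
  assumes state: "r \<in> states MVMMMM k" and k: "k \<ge> 2"
begin

lemma subset: "r \<subseteq> faces k \<times> faces k"
  and linear: "strict_linear_order_on (faces k) r"
  using state unfolding states_MVMMMM strict_total_order_def by auto

lemma trans: "(x, y) \<in> r \<Longrightarrow> (y, z) \<in> r \<Longrightarrow> (x, z) \<in> r"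
  using linear unfolding strict_linear_order_on_def by (meson transD)

lemma asym: "(x, y) \<in> r \<Longrightarrow> (y, x) \<notin> r"
  using linear trans unfolding strict_linear_order_on_def by (meson irreflD)

lemma total: "x \<in> faces k \<Longrightarrow> y \<in> faces k \<Longrightarrow> x \<noteq> y \<Longrightarrow> (x, y) \<in> r \<or> (y, x) \<in> r"
  using linear unfolding strict_linear_order_on_def total_on_def by blast

lemma top_bottom: "e \<in> creases k \<Longrightarrow> (top_wing e, bottom_wing e) \<in> r"
  using state unfolding states_MVMMMM by blast

lemma not_straddles:
  "e \<in> creases k \<Longrightarrow> f \<in> creases k \<Longrightarrow> e \<noteq> f \<Longrightarrow> target_class e = target_class f \<Longrightarrow> \<not> straddles r e f"
  using state unfolding states_MVMMMM by blast

lemma upper_row_order: "row_order k (upper_row r)"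
proof
  show "upper_row r \<subseteq> {1..2 * k} \<times> {1..2 * k}"
    using subset unfolding upper_row_def faces_def upper_faces_def lower_faces_def by auto
  have "total_on {1..2 * k} (upper_row r)"
    unfolding total_on_def
  proof (intro ballI impI)
    fix c d assume "c \<in> {1..2 * k}" "d \<in> {1..2 * k}" "c \<noteq> d"
    then show "(c, d) \<in> upper_row r \<or> (d, c) \<in> upper_row r"
      using total[of "FaceA c" "FaceA d"] unfolding upper_row_def faces_def upper_faces_def by simp
  qed
  moreover have "irrefl (upper_row r)"
    by (rule irreflI) (metis CollectD asym case_prodD upper_row_def)
  moreover have "Relation.trans (upper_row r)"
    by (rule transI) (metis (no_types, lifting) CollectD CollectI case_prodD case_prodI trans upper_row_def)
  ultimately show "strict_linear_order_on {1..2 * k} (upper_row r)"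
    by (simp add: strict_linear_order_on_def)
  have U: "CreaseU (odd_col i) \<in> creases k" if "1 \<le> i" "i \<le> k" for i
    using that unfolding creases_def odd_col_def by (auto simp: image_iff)
  have U': "CreaseU (even_col i) \<in> creases k" if "1 \<le> i" "i < k" for i
    using that unfolding creases_def even_col_def by (auto simp: image_iff)
  fix i :: nat assume i: "1 \<le> i"
  have next_i: "1 \<le> i + 1" by simp
  show "(odd_col i, even_col i) \<in> upper_row r" if "i \<le> k"
    using top_bottom[OF U[OF i that]] i
    by (simp add: upper_row_def crease_wings del: top_wing.simps bottom_wing.simps)
  show "(odd_col (i + 1), even_col i) \<in> upper_row r" if "i < k"
    using top_bottom[OF U'[OF i that]] i
    by (simp add: upper_row_def crease_wings del: top_wing.simps bottom_wing.simps)
  show "\<not> ((odd_col i, odd_col (i + 1)) \<in> upper_row r \<and> (odd_col (i + 1), even_col i) \<in> upper_row r \<and>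
         (even_col i, even_col (i + 1)) \<in> upper_row r) \<and>
      \<not> ((odd_col (i + 1), odd_col i) \<in> upper_row r \<and> (odd_col i, even_col (i + 1)) \<in> upper_row r \<and>
         (even_col (i + 1), even_col i) \<in> upper_row r)" if "i < k"
  proof -
    let ?e = "CreaseU (odd_col i)" and ?f = "CreaseU (odd_col (i + 1))"
    have "?e \<in> creases k" "?f \<in> creases k" "?e \<noteq> ?f" "target_class ?e = target_class ?f"
      using i that U[of i] U[of "i + 1"] by (auto simp: odd_col_def)
    then have "\<not> straddles r ?e ?f" "\<not> straddles r ?f ?e"
      using not_straddles by metis+
    then show ?thesis
      unfolding straddles_def upper_row_def crease_wings[OF i] crease_wings[OF next_i] by simp
  qed
  show "\<not> ((odd_col (i + 1), odd_col (i + 2)) \<in> upper_row r \<and> (odd_col (i + 2), even_col i) \<in> upper_row r \<and>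
         (even_col i, even_col (i + 1)) \<in> upper_row r) \<and>
      \<not> ((odd_col (i + 2), odd_col (i + 1)) \<in> upper_row r \<and> (odd_col (i + 1), even_col (i + 1)) \<in> upper_row r \<and>
         (even_col (i + 1), even_col i) \<in> upper_row r)" if "i + 1 < k"
  proof -
    let ?e = "CreaseU (even_col i)" and ?f = "CreaseU (even_col (i + 1))"
    have "?e \<in> creases k" "?f \<in> creases k" "?e \<noteq> ?f" "target_class ?e = target_class ?f"
      using i that U'[of i] U'[of "i + 1"] by (auto simp: even_col_def)
    then have "\<not> straddles r ?e ?f" "\<not> straddles r ?f ?e"
      using not_straddles by metis+
    then show ?thesis
      unfolding straddles_def upper_row_def crease_wings[OF i] crease_wings[OF next_i] by simp
  qed
qed

end

text \<open>Turning the strip over exchanges the two rows and reverses the order; this preserves the states.\<close>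

fun flip :: "face \<Rightarrow> face" where
  "flip (FaceA c) = FaceB c"
| "flip (FaceB c) = FaceA c"

fun flip_crease :: "crease \<Rightarrow> crease" where
  "flip_crease (CreaseH c) = CreaseH c"
| "flip_crease (CreaseU i) = CreaseL i"
| "flip_crease (CreaseL i) = CreaseU i"

definition flip_order :: "face rel \<Rightarrow> face rel" where
  "flip_order r = {(x, y). (flip y, flip x) \<in> r}"

lemma flip_flip [simp]: "flip (flip x) = x"
  by (cases x) auto

lemma flip_in_faces [simp]: "flip x \<in> faces k \<longleftrightarrow> x \<in> faces k"
  by (cases x) (auto simp: faces_def upper_faces_def lower_faces_def)

lemma flip_crease:
  shows "top_wing (flip_crease e) = flip (bottom_wing e)"
    and "bottom_wing (flip_crease e) = flip (top_wing e)"
    and "flip_crease e \<in> creases k \<longleftrightarrow> e \<in> creases k"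
    and "flip_crease e = flip_crease f \<longleftrightarrow> e = f"
    and "target_class (flip_crease e) = target_class e"
  by (cases e; cases f; auto simp: creases_def)+

lemma flip_order_state:
  assumes "r \<in> states MVMMMM k"
  shows "flip_order r \<in> states MVMMMM k"
proof -
  have order: "r \<subseteq> faces k \<times> faces k" "trans r" "irrefl r" "total_on (faces k) r"
    and top_bottom: "\<And>e. e \<in> creases k \<Longrightarrow> (top_wing e, bottom_wing e) \<in> r"
    and nc: "\<And>e f. e \<in> creases k \<Longrightarrow> f \<in> creases k \<Longrightarrow> e \<noteq> f \<Longrightarrow>
      target_class e = target_class f \<Longrightarrow> \<not> straddles r e f"
    using assms unfolding states_MVMMMM strict_total_order_def strict_linear_order_on_def by auto
  have "flip_order r \<subseteq> faces k \<times> faces k"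
    using order(1) flip_in_faces unfolding flip_order_def by blast
  moreover have "trans (flip_order r)"
    using order(2) unfolding flip_order_def trans_def by blast
  moreover have "irrefl (flip_order r)"
    using order(3) unfolding flip_order_def irrefl_def by blast
  moreover have "total_on (faces k) (flip_order r)"
    unfolding total_on_def
  proof (intro ballI impI)
    fix x y assume "x \<in> faces k" "y \<in> faces k" "x \<noteq> y"
    then have "flip x \<in> faces k" "flip y \<in> faces k" "flip x \<noteq> flip y"
      by (auto dest: arg_cong[of _ _ flip])
    then show "(x, y) \<in> flip_order r \<or> (y, x) \<in> flip_order r"
      using order(4) unfolding flip_order_def total_on_def by blast
  qed
  moreover have "(top_wing e, bottom_wing e) \<in> flip_order r" if "e \<in> creases k" for e
    using top_bottom[of "flip_crease e"] that by (simp add: flip_order_def flip_crease)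
  \<comment> \<open>Reversal exchanges the roles: this crossing in the flipped order is
    \<open>flip_crease f\<close> straddling \<open>flip_crease e\<close> in
    \<open>r\<close>.\<close>
  moreover have "\<not> straddles (flip_order r) e f"
    if "e \<in> creases k" "f \<in> creases k" "e \<noteq> f" "target_class e = target_class f" for e f
    using nc[of "flip_crease f" "flip_crease e"] that
    by (auto simp: straddles_def flip_order_def flip_crease)
  ultimately show ?thesis
    unfolding states_MVMMMM strict_total_order_def strict_linear_order_on_def by blast
qed

lemma upper_row_flip: "upper_row (flip_order r) = lower_row r"
  unfolding upper_row_def lower_row_def flip_order_def by auto

section \<open>Nested and disjoint columns; the rows determine the state\<close>

context state
begin

lemma lower_row_order: "row_order k (lower_row r)"
proof -
  interpret flipped: state k "flip_order r"
    using state k by unfold_locales (auto intro: flip_order_state)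
  show ?thesis
    using flipped.upper_row_order unfolding upper_row_flip .
qed

text \<open>If column \<open>d\<close> both starts and ends before column \<open>c\<close>, the two
  are not nested, hence disjoint, and \<open>FaceB d\<close> precedes \<open>FaceA c\<close>.
  Otherwise \<open>FaceA c\<close> reaches \<open>FaceB d\<close> through \<open>FaceA d\<close> or
  \<open>FaceB c\<close>.\<close>

lemma upper_before_lower_iff:
  assumes c: "c \<in> {1..2 * k}" and d: "d \<in> {1..2 * k}"
  shows "(FaceA c, FaceB d) \<in> r \<longleftrightarrow> \<not> ((d, c) \<in> upper_row r \<and> (c, d) \<in> lower_row r)"
proof (cases "c = d")
  case True
  then show ?thesis
    using top_bottom[of "CreaseH c"] asym c by (auto simp: creases_def upper_row_def)
next
  case False
  have H: "CreaseH c \<in> creases k" "CreaseH d \<in> creases k"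
    using c d unfolding creases_def by auto
  have AB: "(FaceA c, FaceB c) \<in> r" "(FaceA d, FaceB d) \<in> r"
    using top_bottom[OF H(1)] top_bottom[OF H(2)] by auto
  have tot: "(FaceA c, FaceA d) \<in> r \<or> (FaceA d, FaceA c) \<in> r"
    "(FaceB c, FaceB d) \<in> r \<or> (FaceB d, FaceB c) \<in> r"
    "(FaceA c, FaceB d) \<in> r \<or> (FaceB d, FaceA c) \<in> r"
    using total[of "FaceA c" "FaceA d"] total[of "FaceB c" "FaceB d"]
      total[of "FaceA c" "FaceB d"] c d False
    by (simp_all add: faces_def upper_faces_def lower_faces_def image_iff)
  have "\<not> straddles r (CreaseH d) (CreaseH c)"
    using not_straddles[OF H(2,1)] False by simp
  then have "\<not> ((FaceA d, FaceA c) \<in> r \<and> (FaceA c, FaceB d) \<in> r \<and> (FaceB d, FaceB c) \<in> r)"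
    unfolding straddles_def by simp
  then show ?thesis
    using AB tot trans asym unfolding upper_row_def lower_row_def mem_Collect_eq prod.case by metis
qed

lemma odd_cols_agree:
  assumes i: "1 \<le> i" "i < k"
  shows "(odd_col (i + 1), odd_col i) \<in> upper_row r \<longleftrightarrow> (odd_col (i + 1), odd_col i) \<in> lower_row r"
proof -
  let ?x = "odd_col i" and ?y = "odd_col (i + 1)" and ?z = "even_col i"
  interpret upper: row_order k "upper_row r" by (rule upper_row_order)
  interpret lower: row_order k "lower_row r" by (rule lower_row_order)
  have col: "?x \<in> {1..2 * k}" "?y \<in> {1..2 * k}" "?z \<in> {1..2 * k}"
    using i by (auto simp: odd_col_def even_col_def)
  have D: "(FaceA ?z, FaceB ?z) \<in> r"
    using top_bottom[of "CreaseH ?z"] col by (simp add: creases_def)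
  have adjacent: "(FaceA ?x, FaceA ?z) \<in> r" "(FaceA ?y, FaceA ?z) \<in> r"
    "(FaceB ?z, FaceB ?x) \<in> r" "(FaceB ?z, FaceB ?y) \<in> r"
    using upper.odd_even[of i] upper.next_odd_even[of i] lower.odd_even[of i]
      lower.next_odd_even[of i] i by (auto simp: upper_row_def lower_row_def)
  \<comment> \<open>Both odd columns enclose column \<open>?z\<close>, so they are nested. Nested
    columns have opposite orders in the two rows, hence equal ones after the reversal.\<close>
  have "(FaceA ?x, FaceB ?y) \<in> r" "(FaceA ?y, FaceB ?x) \<in> r"
    using adjacent D trans by blast+
  then show ?thesis
    using upper_before_lower_iff[OF col(1,2)] upper_before_lower_iff[OF col(2,1)]
      upper.odd_cols_comparable[of i "i + 1"] lower.odd_cols_comparable[of i "i + 1"] i by auto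
qed

end

lemma state_unique:
  assumes "r \<in> states MVMMMM k" "r' \<in> states MVMMMM k" "k \<ge> 2"
    and upper: "upper_row r = upper_row r'" and lower: "lower_row r = lower_row r'"
  shows "r = r'"
proof -
  have "r \<subseteq> r'" if "r \<in> states MVMMMM k" "r' \<in> states MVMMMM k"
    and upper: "upper_row r = upper_row r'" and lower: "lower_row r = lower_row r'" for r r'
  proof (rule subrelI)
    interpret r: state k r using that \<open>k \<ge> 2\<close> by unfold_locales
    interpret r': state k r' using that \<open>k \<ge> 2\<close> by unfold_locales
    fix x y assume xy: "(x, y) \<in> r"
    then have faces: "x \<in> faces k" "y \<in> faces k"
      using r.subset by auto
    have mixed: "(FaceA c, FaceB d) \<in> r \<longleftrightarrow> (FaceA c, FaceB d) \<in> r'"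
      if "c \<in> {1..2 * k}" "d \<in> {1..2 * k}" for c d
      using r.upper_before_lower_iff[OF that] r'.upper_before_lower_iff[OF that] upper lower by simp
    show "(x, y) \<in> r'"
    proof (cases x; cases y)
      fix c d assume eq: "x = FaceA c" "y = FaceA d"
      then show ?thesis using xy upper unfolding upper_row_def by (auto simp: set_eq_iff)
    next
      fix c d assume eq: "x = FaceB c" "y = FaceB d"
      then show ?thesis using xy lower unfolding lower_row_def by (auto simp: set_eq_iff)
    next
      fix c d assume eq: "x = FaceA c" "y = FaceB d"
      then show ?thesis
        using mixed[of c d] xy faces by (auto simp: faces_def upper_faces_def lower_faces_def)
    next
      fix d c assume eq: "x = FaceB d" "y = FaceA c"
      then have "(FaceA c, FaceB d) \<notin> r'"
        using mixed[of c d] xy faces r.asym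
        by (auto simp: faces_def upper_faces_def lower_faces_def)
      then show ?thesis
        using r'.total faces eq by blast
    qed
  qed
  from this[of r r'] this[of r' r] assms show ?thesis by blast
qed

section \<open>Construction of states\<close>

text \<open>Ranks may leave gaps, so a state can be given by piecewise formulas instead of a
  permutation.\<close>

definition rank_order :: "nat \<Rightarrow> (face \<Rightarrow> int) \<Rightarrow> face rel" where
  "rank_order k f = {(x, y). x \<in> faces k \<and> y \<in> faces k \<and> f x < f y}"

lemma wings_in_faces: "e \<in> creases k \<Longrightarrow> top_wing e \<in> faces k \<and> bottom_wing e \<in> faces k"
  unfolding creases_def faces_def upper_faces_def lower_faces_def by auto

lemma rank_order_state:
  assumes inj: "inj_on f (faces k)"
    and top_bottom: "\<And>e. e \<in> creases k \<Longrightarrow> f (top_wing e) < f (bottom_wing e)"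
    and nc: "\<And>e e'. e \<in> creases k \<Longrightarrow> e' \<in> creases k \<Longrightarrow> e \<noteq> e' \<Longrightarrow>
      target_class e = target_class e' \<Longrightarrow>
      \<not> (f (top_wing e) < f (top_wing e') \<and> f (top_wing e') < f (bottom_wing e) \<and>
         f (bottom_wing e) < f (bottom_wing e'))"
  shows "rank_order k f \<in> states MVMMMM k"
proof -
  have "total_on (faces k) (rank_order k f)"
    using inj unfolding total_on_def rank_order_def inj_on_def by (auto simp: not_less le_less)
  then have "strict_total_order k (rank_order k f)"
    unfolding strict_total_order_def strict_linear_order_on_def
    by (auto simp: rank_order_def intro!: transI irreflI)
  then show ?thesis
    unfolding states_MVMMMM straddles_def using top_bottom nc wings_in_faces
    by (auto simp: rank_order_def)
qed

lemma crease_cases: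
  assumes "e \<in> creases k"
  obtains i where "1 \<le> i" "i \<le> k" "e = CreaseH (odd_col i)"
  | i where "1 \<le> i" "i \<le> k" "e = CreaseH (even_col i)"
  | i where "1 \<le> i" "i \<le> k" "e = CreaseU (odd_col i)"
  | i where "1 \<le> i" "i \<le> k" "e = CreaseL (odd_col i)"
  | i where "1 \<le> i" "i < k" "e = CreaseU (even_col i)"
  | i where "1 \<le> i" "i < k" "e = CreaseL (even_col i)"
proof -
  have parity: "\<exists>i. 1 \<le> i \<and> (i \<le> k \<and> c = 2 * i - 1 \<or> i \<le> k \<and> c = 2 * i)"
    if "1 \<le> c" "c \<le> 2 * k" for c :: nat
    using that by presburger
  have parity': "\<exists>i. 1 \<le> i \<and> (i \<le> k \<and> c = 2 * i - 1 \<or> i < k \<and> c = 2 * i)"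
    if "1 \<le> c" "c \<le> 2 * k - 1" for c :: nat
    using that by presburger
  show ?thesis
  proof (cases e)
    case (CreaseH c)
    then have "1 \<le> c" "c \<le> 2 * k"
      using assms unfolding creases_def by auto
    then show ?thesis
      using parity[of c] CreaseH that(1,2) unfolding odd_col_def even_col_def by blast
  next
    case (CreaseU c)
    then have "1 \<le> c" "c \<le> 2 * k - 1"
      using assms unfolding creases_def by auto
    then show ?thesis
      using parity'[of c] CreaseU that(3,5) unfolding odd_col_def even_col_def by blast
  next
    case (CreaseL c)
    then have "1 \<le> c" "c \<le> 2 * k - 1"
      using assms unfolding creases_def by auto
    then show ?thesis
      using parity'[of c] CreaseL that(4,6) unfolding odd_col_def even_col_def by blast
  qed
qed

lemma face_cases:
  assumes "z \<in> faces k"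
  obtains i where "1 \<le> i" "i \<le> k" "z = FaceA (odd_col i)"
  | i where "1 \<le> i" "i \<le> k" "z = FaceA (even_col i)"
  | i where "1 \<le> i" "i \<le> k" "z = FaceB (odd_col i)"
  | i where "1 \<le> i" "i \<le> k" "z = FaceB (even_col i)"
  using assms unfolding faces_def upper_faces_def lower_faces_def columns_eq by auto

text \<open>The layout of a state whose first upper and last lower face lie in column \<open>O\<^sub>t\<close>: the columns
  after \<open>O\<^sub>t\<close> and the columns before it form two blocks, each of which occurs once in the upper
  row and once, reversed, in the lower row. The parameters give the places \<open>x\<close>, \<open>y\<close> (upper) and
  \<open>x'\<close>, \<open>y'\<close> (lower) of the block after and the block before \<open>O\<^sub>t\<close>. A block spans less than \<open>4k\<close>
  ranks, so offsets in multiples of \<open>10k\<close> keep the blocks apart.\<close>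

locale block_layout =
  fixes k t x y x' y' :: int
  assumes t: "1 \<le> t" "t \<le> k"
    and places: "x = 1 \<and> y = 2 \<and> x' = 4 \<and> y' = 3 \<or> x = 1 \<and> y = 3 \<and> x' = 2 \<and> y' = 4 \<or>
      x = 3 \<and> y = 1 \<and> x' = 4 \<and> y' = 2 \<or> x = 2 \<and> y = 1 \<and> x' = 3 \<and> y' = 4"
begin

text \<open>In the upper row the block after \<open>O\<^sub>t\<close> climbs through the odd columns
  and returns through the even ones to \<open>D\<^sub>t\<close>; the block before it is centred at
  \<open>10 * k * y\<close>. The lower ranks negate the offsets, which reverses each block. Column
  \<open>O\<^sub>t\<close> encloses all others.\<close>

definition upper_odd :: "int \<Rightarrow> int" where
  "upper_odd i = (if i = t then 0 else if t < i then 10 * k * x + i else 10 * k * y - i)"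

definition upper_even :: "int \<Rightarrow> int" where
  "upper_even i = (if t \<le> i then 10 * k * x + 4 * k - i else 10 * k * y + i)"

definition lower_odd :: "int \<Rightarrow> int" where
  "lower_odd i = (if i = t then 50 * k else if t < i then 10 * k * x' - i else 10 * k * y' + i)"

definition lower_even :: "int \<Rightarrow> int" where
  "lower_even i = (if t \<le> i then 10 * k * x' - 4 * k + i else 10 * k * y' - i)"

lemmas rank_defs = upper_odd_def upper_even_def lower_odd_def lower_even_def

fun rank :: "face \<Rightarrow> int" where
  "rank (FaceA c) = (if odd c then upper_odd ((int c + 1) div 2) else upper_even (int c div 2))"
| "rank (FaceB c) = (if odd c then lower_odd ((int c + 1) div 2) else lower_even (int c div 2))"

lemma rank_columns:
  assumes "1 \<le> i"
  shows "rank (FaceA (odd_col i)) = upper_odd (int i)"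
    and "rank (FaceA (even_col i)) = upper_even (int i)"
    and "rank (FaceB (odd_col i)) = lower_odd (int i)"
    and "rank (FaceB (even_col i)) = lower_even (int i)"
proof -
  have "(int (odd_col i) + 1) div 2 = int i" "int (even_col i) div 2 = int i"
    using assms by (auto simp: odd_col_def even_col_def)
  then show "rank (FaceA (odd_col i)) = upper_odd (int i)"
    and "rank (FaceA (even_col i)) = upper_even (int i)"
    and "rank (FaceB (odd_col i)) = lower_odd (int i)"
    and "rank (FaceB (even_col i)) = lower_even (int i)"
    using assms by simp_all
qed

lemma rank_eq:
  assumes "1 \<le> i" "i \<le> k" "1 \<le> j" "j \<le> k"
  shows "upper_odd i = upper_odd j \<longleftrightarrow> i = j"
    and "upper_even i = upper_even j \<longleftrightarrow> i = j"
    and "lower_odd i = lower_odd j \<longleftrightarrow> i = j"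
    and "lower_even i = lower_even j \<longleftrightarrow> i = j"
    and "upper_odd i \<noteq> upper_even j" "upper_odd i \<noteq> lower_odd j" "upper_odd i \<noteq> lower_even j"
    and "upper_even i \<noteq> lower_odd j" "upper_even i \<noteq> lower_even j"
    and "lower_odd i \<noteq> lower_even j"
  \<comment> \<open>Each of the four placements turns the block offsets into numeral multiples of
    \<open>k\<close>, which leaves linear arithmetic.\<close>
  using places t assms unfolding rank_defs
  by (elim disjE conjE; hypsubst; smt (verit))+

lemma rank_top_bottom:
  assumes "1 \<le> i" "i \<le> k"
  shows "upper_odd i < lower_odd i" "upper_even i < lower_even i"
    and "upper_odd i < upper_even i" "lower_even i < lower_odd i"
    and "i < k \<Longrightarrow> upper_odd (1 + i) < upper_even i" "i < k \<Longrightarrow> lower_even i < lower_odd (1 + i)"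
  using places t assms unfolding rank_defs
  by (elim disjE conjE; hypsubst; smt (verit))+

text \<open>Opposite offsets nest the columns of one block. Columns of different blocks are nested
  or disjoint because in \<open>places\<close> the pairs \<open>(x, x')\<close> and
  \<open>(y, y')\<close> are.\<close>

lemma column_creases_noncrossing:
  assumes "1 \<le> i" "i \<le> k" "1 \<le> j" "j \<le> k"
  shows "i \<noteq> j \<Longrightarrow>
      \<not> (upper_odd i < upper_odd j \<and> upper_odd j < lower_odd i \<and> lower_odd i < lower_odd j)"
    and "i \<noteq> j \<Longrightarrow>
      \<not> (upper_even i < upper_even j \<and> upper_even j < lower_even i \<and> lower_even i < lower_even j)"
    and "\<not> (upper_odd i < upper_even j \<and> upper_even j < lower_odd i \<and> lower_odd i < lower_even j)"
    and "\<not> (upper_even i < upper_odd j \<and> upper_odd j < lower_even i \<and> lower_even i < lower_odd j)"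
  using places t assms unfolding rank_defs
  by (elim disjE conjE; hypsubst; smt (verit))+

text \<open>Only the E and W creases at \<open>O\<^sub>t\<close> leave a block. In either row they
  join \<open>O\<^sub>t\<close> to the far end of a block, so they contain or avoid each block as a
  whole.\<close>

lemma east_creases_noncrossing:
  assumes "1 \<le> i" "i \<le> k" "1 \<le> j" "j \<le> k"
  shows "i \<noteq> j \<Longrightarrow>
      \<not> (upper_odd i < upper_odd j \<and> upper_odd j < upper_even i \<and> upper_even i < upper_even j)"
    and "i \<noteq> j \<Longrightarrow>
      \<not> (lower_even i < lower_even j \<and> lower_even j < lower_odd i \<and> lower_odd i < lower_odd j)"
    and "\<not> (upper_odd i < lower_even j \<and> lower_even j < upper_even i \<and> upper_even i < lower_odd j)"
    and "\<not> (lower_even i < upper_odd j \<and> upper_odd j < lower_odd i \<and> lower_odd i < upper_even j)"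
  using places t assms unfolding rank_defs
  by (elim disjE conjE; hypsubst; smt (verit))+

lemma west_creases_noncrossing:
  assumes "1 \<le> i" "i < k" "1 \<le> j" "j < k"
  shows "i \<noteq> j \<Longrightarrow> \<not> (upper_odd (1 + i) < upper_odd (1 + j) \<and>
      upper_odd (1 + j) < upper_even i \<and> upper_even i < upper_even j)"
    and "i \<noteq> j \<Longrightarrow> \<not> (lower_even i < lower_even j \<and> lower_even j < lower_odd (1 + i) \<and>
      lower_odd (1 + i) < lower_odd (1 + j))"
    and "\<not> (upper_odd (1 + i) < lower_even j \<and> lower_even j < upper_even i \<and>
      upper_even i < lower_odd (1 + j))"
    and "\<not> (lower_even i < upper_odd (1 + j) \<and> upper_odd (1 + j) < lower_odd (1 + i) \<and>
      lower_odd (1 + i) < upper_even j)"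
  using places t assms unfolding rank_defs
  by (elim disjE conjE; hypsubst; smt (verit))+

text \<open>Even columns \<open>t - 1\<close> and \<open>t\<close> lie in different blocks, so for
  \<open>i + 1 = t\<close> their order is that of the blocks. All other comparisons are the same in
  every placement.\<close>

lemma rank_pivots:
  assumes "1 \<le> i" "i < k"
  shows "upper_even (1 + i) < upper_even i \<longleftrightarrow> (if x < y then t \<le> i + 1 else t \<le> i)"
    and "upper_odd (1 + i) < upper_odd i \<longleftrightarrow> i < t"
    and "lower_even i < lower_even (1 + i) \<longleftrightarrow> (if y' < x' then t \<le> i + 1 else t \<le> i)"
    and "lower_odd i < lower_odd (1 + i) \<longleftrightarrow> i < t"
  using places t assms unfolding rank_defs
  by (elim disjE conjE; hypsubst; smt (verit))+

lemma rank_state: "rank_order (nat k) rank \<in> states MVMMMM (nat k)"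
proof (rule rank_order_state)
  show "inj_on rank (faces (nat k))"
  proof (rule inj_onI)
    fix z z' assume "z \<in> faces (nat k)" "z' \<in> faces (nat k)" "rank z = rank z'"
    then show "z = z'"
      by (elim face_cases) (simp_all add: rank_columns rank_eq rank_eq(5-)[symmetric] del: rank.simps)
  qed
next
  fix e assume "e \<in> creases (nat k)"
  then show "rank (top_wing e) < rank (bottom_wing e)"
    by (elim crease_cases)
      (simp_all add: crease_wings rank_columns rank_top_bottom
        del: rank.simps top_wing.simps(2,3) bottom_wing.simps(2,3))
next
  fix e e' assume "e \<in> creases (nat k)" "e' \<in> creases (nat k)" "e \<noteq> e'"
    "target_class e = target_class e'"
  then show "\<not> (rank (top_wing e) < rank (top_wing e') \<and> rank (top_wing e') < rank (bottom_wing e) \<and>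
         rank (bottom_wing e) < rank (bottom_wing e'))"
    by (elim crease_cases)
      (simp_all add: crease_wings rank_columns odd_col_eq_iff even_col_eq_iff column_creases_noncrossing
        east_creases_noncrossing west_creases_noncrossing
        del: rank.simps top_wing.simps(2,3) bottom_wing.simps(2,3) de_Morgan_conj not_less)
qed

lemma rank_rows:
  "(even_col (i + 1), even_col i) \<in> upper_row (rank_order (nat k) rank) \<longleftrightarrow>
      upper_even (1 + int i) < upper_even (int i)"
  "(odd_col (i + 1), odd_col i) \<in> upper_row (rank_order (nat k) rank) \<longleftrightarrow>
      upper_odd (1 + int i) < upper_odd (int i)"
  "(even_col (i + 1), even_col i) \<in> lower_row (rank_order (nat k) rank) \<longleftrightarrow>
      lower_even (int i) < lower_even (1 + int i)"
  "(odd_col (i + 1), odd_col i) \<in> lower_row (rank_order (nat k) rank) \<longleftrightarrow>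
      lower_odd (int i) < lower_odd (1 + int i)"
  if "1 \<le> i" "i < nat k"
proof -
  have cols: "odd_col i \<in> {1..2 * nat k}" "odd_col (i + 1) \<in> {1..2 * nat k}"
    "even_col i \<in> {1..2 * nat k}" "even_col (i + 1) \<in> {1..2 * nat k}"
    using that by (auto simp: odd_col_def even_col_def)
  have "FaceA ` {1..2 * nat k} \<subseteq> faces (nat k)" "FaceB ` {1..2 * nat k} \<subseteq> faces (nat k)"
    by (auto simp: faces_def upper_faces_def lower_faces_def)
  then have faces: "FaceA c \<in> faces (nat k)" "FaceB c \<in> faces (nat k)" if "c \<in> {1..2 * nat k}" for c
    using that by auto
  show "(even_col (i + 1), even_col i) \<in> upper_row (rank_order (nat k) rank) \<longleftrightarrow>
      upper_even (1 + int i) < upper_even (int i)"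
    and "(odd_col (i + 1), odd_col i) \<in> upper_row (rank_order (nat k) rank) \<longleftrightarrow>
      upper_odd (1 + int i) < upper_odd (int i)"
    and "(even_col (i + 1), even_col i) \<in> lower_row (rank_order (nat k) rank) \<longleftrightarrow>
      lower_even (int i) < lower_even (1 + int i)"
    and "(odd_col (i + 1), odd_col i) \<in> lower_row (rank_order (nat k) rank) \<longleftrightarrow>
      lower_odd (int i) < lower_odd (1 + int i)"
    using that faces[OF cols(1)] faces[OF cols(2)] faces[OF cols(3)] faces[OF cols(4)]
    by (simp_all add: upper_row_def lower_row_def rank_order_def rank_columns del: rank.simps)
qed

lemma rank_has_pivots:
  shows "int a = 2 * (t - 1) + (if x < y then 0 else 1) \<Longrightarrow>
      has_pivot (nat k) (upper_row (rank_order (nat k) rank)) a"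
    and "int b = 2 * (t - 1) + (if y' < x' then 0 else 1) \<Longrightarrow>
      has_pivot (nat k) (lower_row (rank_order (nat k) rank)) b"
proof -
  show "has_pivot (nat k) (upper_row (rank_order (nat k) rank)) a"
    if a: "int a = 2 * (t - 1) + (if x < y then 0 else 1)"
    unfolding has_pivot_def
  proof
    fix i assume i: "i \<in> {1..<nat k}"
    then have "1 \<le> int i" "int i < k" by auto
    moreover have "a \<le> 2 * i \<longleftrightarrow> (if x < y then t \<le> int i + 1 else t \<le> int i)"
      "2 * i \<le> a \<longleftrightarrow> int i < t"
      using a by (auto split: if_splits)
    ultimately show "((even_col (i + 1), even_col i) \<in> upper_row (rank_order (nat k) rank) \<longleftrightarrow> a \<le> 2 * i) \<and>
      ((odd_col (i + 1), odd_col i) \<in> upper_row (rank_order (nat k) rank) \<longleftrightarrow> 2 * i \<le> a)"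
      using i rank_rows[of i] rank_pivots[of "int i"] by simp
  qed
  show "has_pivot (nat k) (lower_row (rank_order (nat k) rank)) b"
    if b: "int b = 2 * (t - 1) + (if y' < x' then 0 else 1)"
    unfolding has_pivot_def
  proof
    fix i assume i: "i \<in> {1..<nat k}"
    then have "1 \<le> int i" "int i < k" by auto
    moreover have "b \<le> 2 * i \<longleftrightarrow> (if y' < x' then t \<le> int i + 1 else t \<le> int i)"
      "2 * i \<le> b \<longleftrightarrow> int i < t"
      using b by (auto split: if_splits)
    ultimately show "((even_col (i + 1), even_col i) \<in> lower_row (rank_order (nat k) rank) \<longleftrightarrow> b \<le> 2 * i) \<and>
      ((odd_col (i + 1), odd_col i) \<in> lower_row (rank_order (nat k) rank) \<longleftrightarrow> 2 * i \<le> b)"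
      using i rank_rows[of i] rank_pivots[of "int i"] by simp
  qed
qed

end

section \<open>States and pairs of pivots\<close>

lemma ex_state_with_pivots:
  assumes "a \<in> {1..2 * k - 1}" "b \<in> {1..2 * k - 1}" and half: "a div 2 = b div 2"
  obtains r where "r \<in> states MVMMMM k" "has_pivot k (upper_row r) a" "has_pivot k (lower_row r) b"
proof -
  \<comment> \<open>As \<open>a div 2 = b div 2\<close>, the words of \<open>a\<close> and
    \<open>b\<close> both begin with odd column \<open>t\<close>.\<close>
  define t where "t = int (a div 2) + 1"
  \<comment> \<open>An even pivot puts the block after \<open>O\<^sub>t\<close> first in its word,
    an odd pivot the block before it; the lower row reads the word of \<open>b\<close> backwards.
    Equal parities nest the columns of one block inside those of the other, different parities put
    them side by side.\<close>
  define x y x' y' :: int where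
    "x = (if even a then 1 else if even b then 3 else 2)" and
    "y = (if odd a then 1 else if even b then 2 else 3)" and
    "x' = (if even b then 4 else if even a then 2 else 3)" and
    "y' = (if odd b then 4 else if even a then 3 else 2)"
  note xy = x_def y_def x'_def y'_def
  interpret block_layout "int k" t x y x' y'
  proof
    show "1 \<le> t" "t \<le> int k"
      using assms(1) unfolding t_def by auto
  qed (auto simp: xy)
  have "int a = 2 * (t - 1) + (if x < y then 0 else 1)"
    unfolding t_def xy by (auto elim!: evenE oddE)
  moreover have "int b = 2 * (t - 1) + (if y' < x' then 0 else 1)"
    unfolding t_def xy half by (auto elim!: evenE oddE)
  ultimately show ?thesis
    using that[of "rank_order k rank"] rank_state rank_has_pivots[of a] rank_has_pivots[of b]
    by simp
qed

lemma has_rows_iff_pivots: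
  assumes r: "r \<in> states MVMMMM k" and k: "k \<ge> 2"
    and ab: "a \<in> {1..2 * k - 1}" "b \<in> {1..2 * k - 1}"
  shows "has_rows k a b r \<longleftrightarrow> has_pivot k (upper_row r) a \<and> has_pivot k (lower_row r) b"
proof -
  have pivot_iff: "word_order (column_word k p) = R \<longleftrightarrow> has_pivot k R p"
    if R: "row_order k R" and p: "p \<in> {1..2 * k - 1}" for R p
  proof
    assume eq: "word_order (column_word k p) = R"
    \<comment> \<open>That the word itself has pivot \<open>p\<close> is read off from a constructed
      state: its upper row has pivot \<open>p\<close> and therefore equals the word.\<close>
    obtain r' where r': "r' \<in> states MVMMMM k" "has_pivot k (upper_row r') p"
      using ex_state_with_pivots[OF p p refl] by blast
    interpret r': state k r'
      using r' k by unfold_locales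
    show "has_pivot k R p"
      using row_order.column_word_eq[OF r'.upper_row_order k p r'(2)] eq r'(2) by simp
  next
    assume "has_pivot k R p"
    then show "word_order (column_word k p) = R"
      using row_order.column_word_eq[OF R k p] by simp
  qed
  interpret state k r
    using r k by unfold_locales
  show ?thesis
    unfolding has_rows_iff[OF subset] pivot_iff[OF upper_row_order ab(1)]
      pivot_iff[OF lower_row_order ab(2)] ..
qed

lemma B_R_eq: "B_R p = p div 2"
  unfolding B_R_def by simp

lemma FullCompat_iff:
  assumes k: "k \<ge> 2" and ab: "a \<in> {1..2 * k - 1}" "b \<in> {1..2 * k - 1}"
  shows "FullCompat k a b \<longleftrightarrow> B_R a = B_R b"
proof
  assume "FullCompat k a b"
  then obtain r where r: "r \<in> states MVMMMM k" and rows: "has_rows k a b r"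
    unfolding FullCompat_def by blast
  interpret state k r
    using r k by unfold_locales
  \<comment> \<open>Both rows order the odd columns alike, so \<open>a\<close> and \<open>b\<close>
    pass the same even thresholds. These reach \<open>2 * (k - 1)\<close>, enough to fix the halves
    of numbers up to \<open>2 * k - 1\<close>.\<close>
  have iff: "2 * i \<le> a \<longleftrightarrow> 2 * i \<le> b" if "i \<in> {1..<k}" for i
    using rows odd_cols_agree[of i] that unfolding has_rows_iff_pivots[OF r k ab] has_pivot_def
    by auto
  have "a div 2 = b div 2"
  proof -
    have "2 * (a div 2) \<le> b"
      using iff[of "a div 2"] ab by (cases "a div 2 = 0") auto
    moreover have "2 * (b div 2) \<le> a"
      using iff[of "b div 2"] ab by (cases "b div 2 = 0") auto
    ultimately show ?thesis
      by presburger
  qed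
  then show "B_R a = B_R b"
    unfolding B_R_eq .
next
  assume "B_R a = B_R b"
  then obtain r where "r \<in> states MVMMMM k" "has_pivot k (upper_row r) a" "has_pivot k (lower_row r) b"
    using ex_state_with_pivots[OF ab] unfolding B_R_eq by blast
  then show "FullCompat k a b"
    unfolding FullCompat_def using has_rows_iff_pivots[OF _ k ab] by blast
qed

lemma ex1_state:
  assumes k: "k \<ge> 2" and compat: "FullCompat k a b"
  shows "\<exists>!r. r \<in> states MVMMMM k \<and> has_rows k a b r"
proof -
  have "r = r'" if "r \<in> states MVMMMM k" "r' \<in> states MVMMMM k" "has_rows k a b r" "has_rows k a b r'"
    for r r'
  proof -
    have "r \<subseteq> faces k \<times> faces k" "r' \<subseteq> faces k \<times> faces k"
      using that unfolding states_MVMMMM strict_total_order_def by auto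
    then have "upper_row r = upper_row r'" "lower_row r = lower_row r'"
      using that has_rows_iff by metis+
    then show ?thesis
      using state_unique that k by blast
  qed
  then show ?thesis
    using compat unfolding FullCompat_def by blast
qed

lemma ex1_pivots:
  assumes r: "r \<in> states MVMMMM k" and k: "k \<ge> 2"
  shows "\<exists>!p. p \<in> {1..2 * k - 1} \<times> {1..2 * k - 1} \<and> has_rows k (fst p) (snd p) r"
proof -
  interpret state k r
    using r k by unfold_locales
  obtain a where a: "a \<in> {1..2 * k - 1}" "has_pivot k (upper_row r) a"
    using row_order.ex_pivot[OF upper_row_order] k by auto
  obtain b where b: "b \<in> {1..2 * k - 1}" "has_pivot k (lower_row r) b"
    using row_order.ex_pivot[OF lower_row_order] k by auto
  show ?thesis
  proof (rule ex1I[of _ "(a, b)"])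
    show "(a, b) \<in> {1..2 * k - 1} \<times> {1..2 * k - 1} \<and> has_rows k (fst (a, b)) (snd (a, b)) r"
      using a b has_rows_iff_pivots[OF r k] by auto
  next
    fix p assume p: "p \<in> {1..2 * k - 1} \<times> {1..2 * k - 1} \<and> has_rows k (fst p) (snd p) r"
    obtain a' b' where eq: "p = (a', b')" by fastforce
    have ab': "a' \<in> {1..2 * k - 1}" "b' \<in> {1..2 * k - 1}" and rows: "has_rows k a' b' r"
      using p eq by auto
    then show "p = (a, b)"
      using has_rows_iff_pivots[OF r k ab'] has_pivot_unique a b eq by metis
  qed
qed

theorem theorem7p2:
  fixes k m :: nat
  assumes "k \<ge> 2" and "m = 2 * k - 1"
  shows "(\<forall>a\<in>{1..m}. \<forall>b\<in>{1..m}. FullCompat k a b \<longleftrightarrow> B_R a = B_R b) \<and>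
    (\<forall>a\<in>{1..m}. \<forall>b\<in>{1..m}. FullCompat k a b \<longrightarrow>
       (\<exists>!r. r \<in> states MVMMMM k \<and> has_rows k a b r)) \<and>
    (\<forall>r\<in>states MVMMMM k.
       (\<exists>!p. p \<in> {1..m} \<times> {1..m} \<and> has_rows k (fst p) (snd p) r) \<and>
       (\<forall>a\<in>{1..m}. \<forall>b\<in>{1..m}. has_rows k a b r \<longrightarrow> FullCompat k a b))"
  unfolding assms(2)
  using FullCompat_iff[OF assms(1)] ex1_state[OF assms(1)] ex1_pivots[OF _ assms(1)]
  by (intro conjI ballI impI) (auto simp: FullCompat_def)

end
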